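(* Suppose the graph is strongly connected with at least one directed spanning tree and that $\mathbf A-c\lambda_p\mathbf B\mathbf K$ is Hurwitz for all $p=2,\dots,N$. For $p=2,\dots,N$ let $$\tilde\Omega_p=\{\omega_p\in\mathbb R:\ \langle\mathbf G_p(j\omega_p)\mathbf z_p,\mathbf z_p\rangle<0\ \text{for some }\mathbf z_p\in\mathbb C^n\}.$$ If $\tilde\Omega_p=\emptyset$ for all $p=2,3,\dots,N$, then the multi-agent system $$\dot{\mathbf x}(t)=(\mathbf I_N\otimes \mathbf A)\mathbf x(t)-c(\mathbf L\otimes \mathbf B\mathbf K)\mathbf x(t)$$ remains stable independent of gain perturbation in the feedback path of each agent.
   Context: $\mathbf L\in\mathbb R^{N\times N}$ is the Laplacian ($l_{ii}=\sum_{k\ne i}a_{ik}$, $l_{ik}=-a_{ik}$, with nonnegative edge weights $a_{ik}$) of a weighted directed graph on $N$ nodes; under the graph assumption its eigenvalues are $\lambda_1=0$ (simple) and $\lambda_2,\dots,\lambda_N$ with positive real part. Agents: $\dot{\mathbf x}_i=\mathbf A\mathbf x_i+\mathbf B\mathbf u_i$, $i=1,\dots,N$, $\mathbf A\in\mathbb R^{n\times n}$, $\mathbf B\in\mathbb R^{n\times m}$, $(\mathbf A,\mathbf B)$ stabilizable, $\mathbf K\in\mathbb R^{m\times n}$ with $\mathbf A-\mathbf B\mathbf K$ Hurwitz, control $\mathbf u_i=c\mathbf K\sum_k a_{ik}(\mathbf x_k-\mathbf x_i)$ with scalar coupling gain $c$; $\mathbf x=[\mathbf x_1^T,\dots,\mathbf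 x_N^T]^T$. The transformed loop transfer functions are $\mathbf G_p(s)=(s\mathbf I_n-\mathbf A)^{-1}\mathbf B\,c\lambda_p\mathbf K$, $p=2,\dots,N$. $\langle\mathbf x,\mathbf y\rangle=\mathbf x^*\mathbf y$ is the Hermitian inner product, and "$<0$" means real and negative. A gain perturbation is a constant positive definite Hermitian matrix $\boldsymbol\Delta_p\in\mathbb C^{n\times n}$ in the feedback path, giving the perturbed loop $\mathbf G_p(s)\boldsymbol\Delta_p$, whose closed loop is stable when $\mathbf A-c\lambda_p\mathbf B\mathbf K\boldsymbol\Delta_p$ is Hurwitz. Stability of the multi-agent system (for consensus) means simultaneous stability of the $N-1$ transformed loops $p=2,\dots,N$; "independent of gain perturbation" means for every choice of positive definite Hermitian $\boldsymbol\Delta_p$.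
   Formalization: Where jω is an eigenvalue of A, G_p(jω) is undefined; there ω counts as in Ω̃_p if some w, z satisfy (jωI−A)w = cλ_p BKz and ⟨w,z⟩<0. Ignoring such ω makes the claim false: A=diag(0,1), B=I, K=diag(1,2), cλ_p=1, Δ=diag(1,1/2). *)

theory Defs
  imports "HOL-Analysis.Analysis"
begin

section \<open>Weighted directed graphs\<close>

text \<open>A weight \<open>a $ i $ k > 0\<close> means that node \<open>i\<close> receives the state of node \<open>k\<close>, so it is
  an arc from \<open>k\<close> to \<open>i\<close>. Diagonal weights play no role, neither here nor in the Laplacian.\<close>

definition arcs :: "real^'N^'N \<Rightarrow> ('N \<times> 'N) set" where
  "arcs a = {(k, i). k \<noteq> i \<and> a $ i $ k > 0}"

definition strongly_connected :: "('a \<times> 'a) set \<Rightarrow> bool" where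
  "strongly_connected E \<longleftrightarrow> (\<forall>u v. (u, v) \<in> E\<^sup>*)"

definition directed_spanning_tree :: "('a \<times> 'a) set \<Rightarrow> 'a \<Rightarrow> ('a \<times> 'a) set \<Rightarrow> bool" where
  "directed_spanning_tree E r T \<longleftrightarrow>
     T \<subseteq> E \<and> (\<forall>v. (r, v) \<in> T\<^sup>*) \<and>
     (\<forall>u. (u, r) \<notin> T) \<and> (\<forall>v. v \<noteq> r \<longrightarrow> (\<exists>!u. (u, v) \<in> T))"

definition laplacian :: "real^'N^'N \<Rightarrow> real^'N^'N" where
  "laplacian a = (\<chi> i k. if i = k then (\<Sum>j\<in>UNIV - {i}. a $ i $ j) else - (a $ i $ k))"

section \<open>Complex matrices\<close>

abbreviation cmat :: "real^'n^'m \<Rightarrow> complex^'n^'m" where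
  "cmat \<equiv> map_matrix complex_of_real"

definition cscale :: "complex \<Rightarrow> complex^'n^'m \<Rightarrow> complex^'n^'m" where
  "cscale k M = map_matrix ((*) k) M"

definition herm_inner :: "complex^'n \<Rightarrow> complex^'n \<Rightarrow> complex" where
  "herm_inner x y = (\<Sum>i\<in>UNIV. cnj (x $ i) * y $ i)"

text \<open>The order on \<^typ>\<open>complex\<close> is that of \<^theory>\<open>HOL-Library.Complex_Order\<close>:
  \<open>z < 0\<close> means that \<open>z\<close> is real and negative.\<close>

definition pos_def_hermitian :: "complex^'n^'n \<Rightarrow> bool" where
  "pos_def_hermitian M \<longleftrightarrow>
     transpose (map_matrix cnj M) = M \<and> (\<forall>z. z \<noteq> 0 \<longrightarrow> 0 < herm_inner z (M *v z))"

definition eigenvalue :: "complex^'n^'n \<Rightarrow> complex \<Rightarrow> bool" where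
  "eigenvalue M \<mu> \<longleftrightarrow> (\<exists>v. v \<noteq> 0 \<and> M *v v = \<mu> *s v)"

definition hurwitz :: "complex^'n^'n \<Rightarrow> bool" where
  "hurwitz M \<longleftrightarrow> (\<forall>\<mu>. eigenvalue M \<mu> \<longrightarrow> Re \<mu> < 0)"

definition stabilizable :: "real^'n^'n \<Rightarrow> real^'m^'n \<Rightarrow> bool" where
  "stabilizable A B \<longleftrightarrow> (\<exists>F :: real^'n^'m. hurwitz (cmat (A - B ** F)))"

text \<open>\<open>lam 1, \<dots>, lam N\<close> lists the eigenvalues with algebraic multiplicity.\<close>

definition eigenvalue_list :: "complex^'N^'N \<Rightarrow> (nat \<Rightarrow> complex) \<Rightarrow> bool" where
  "eigenvalue_list M lam \<longleftrightarrow> (\<forall>s. det (mat s - M) = (\<Prod>p = 1..CARD('N). s - lam p))"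

section \<open>Transformed loops\<close>

definition loop_tf ::
    "real^'n^'n \<Rightarrow> real^'m^'n \<Rightarrow> real^'n^'m \<Rightarrow> real \<Rightarrow> complex \<Rightarrow> complex \<Rightarrow> complex^'n^'n" where
  "loop_tf A B K c l s =
     matrix_inv (mat s - cmat A) ** cmat B ** cscale (of_real c * l) (cmat K)"

text \<open>If \<open>\<i>\<omega>\<close> is an eigenvalue of \<open>A\<close>, then the transfer function has no value at \<open>\<i>\<omega>\<close>
  (and \<^const>\<open>matrix_inv\<close> is unspecified). There the role of \<open>G(\<i>\<omega>) z\<close> is taken by every
  solution \<open>w\<close> of the equation \<open>(\<i>\<omega>I - A) w = B c\<lambda>K z\<close>, whose unique solution is \<open>G(\<i>\<omega>) z\<close>
  when \<open>\<i>\<omega>\<close> is not an eigenvalue of \<open>A\<close>. Simply ignoring such frequencies is not an option: for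
  \<open>A = diag(0,1)\<close>, \<open>B = I\<close>, \<open>K = diag(1,2)\<close>, \<open>c\<lambda> = 1\<close> no other frequency satisfies the
  condition, but \<open>diag(1,1/2)\<close> is a destabilizing gain perturbation.\<close>

definition Omega_tilde ::
    "real^'n^'n \<Rightarrow> real^'m^'n \<Rightarrow> real^'n^'m \<Rightarrow> real \<Rightarrow> complex \<Rightarrow> real set" where
  "Omega_tilde A B K c l =
     {\<omega>. let s = \<i> * of_real \<omega> in
        if invertible (mat s - cmat A)
        then \<exists>z. herm_inner (loop_tf A B K c l s *v z) z < 0
        else \<exists>z w. (mat s - cmat A) *v w = (cmat B ** cscale (of_real c * l) (cmat K)) *v z
                   \<and> herm_inner w z < 0}"

text \<open>The closed-loop matrix \<open>A - c\<lambda>BK\<Delta>\<close> of the loop perturbed by \<open>\<Delta>\<close>. For \<open>\<Delta> = I\<close> and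
  \<open>\<lambda>\<close> running through the eigenvalues of \<open>L\<close>, these are the diagonal blocks of
  \<open>I\<^sub>N \<otimes> A - c(L \<otimes> BK)\<close> after a change of basis that makes \<open>L\<close> triangular.\<close>

definition closed_loop ::
    "real^'n^'n \<Rightarrow> real^'m^'n \<Rightarrow> real^'n^'m \<Rightarrow> real \<Rightarrow> complex \<Rightarrow> complex^'n^'n \<Rightarrow> complex^'n^'n" where
  "closed_loop A B K c l \<Delta> = cmat A - cscale (of_real c * l) (cmat B ** cmat K ** \<Delta>)"

text \<open>Stability (for consensus) of a system of \<open>N\<close> agents is simultaneous stability of the
  loops \<open>2, \<dots>, N\<close>; the first one, with \<open>\<lambda>\<^sub>1 = 0\<close>, carries the agreement dynamics.\<close>

definition mas_stable ::
    "real^'n^'n \<Rightarrow> real^'m^'n \<Rightarrow> real^'n^'m \<Rightarrow> real \<Rightarrow> nat \<Rightarrow> (nat \<Rightarrow> complex) \<Rightarrow>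
     (nat \<Rightarrow> complex^'n^'n) \<Rightarrow> bool" where
  "mas_stable A B K c N lam \<Delta> \<longleftrightarrow> (\<forall>p\<in>{2..N}. hurwitz (closed_loop A B K c (lam p) (\<Delta> p)))"

definition mas_stable_gain_independent ::
    "real^'n^'n \<Rightarrow> real^'m^'n \<Rightarrow> real^'n^'m \<Rightarrow> real \<Rightarrow> nat \<Rightarrow> (nat \<Rightarrow> complex) \<Rightarrow> bool" where
  "mas_stable_gain_independent A B K c N lam \<longleftrightarrow>
     (\<forall>\<Delta>. (\<forall>p\<in>{2..N}. pos_def_hermitian (\<Delta> p)) \<longrightarrow> mas_stable A B K c N lam \<Delta>)"

end

theory Submission
  imports Defs "HOL-Computational_Algebra.Fundamental_Theorem_Algebra"
begin

text \<open>
  Each loop can be treated separately. Given a positive definite \<open>\<Delta>\<close>, deform the identity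
  into it along the segment \<open>\<Delta>\<^sub>t = (1 - t) I + t \<Delta>\<close>, all of whose points are positive definite.
  No \<open>A - c\<lambda>BK\<Delta>\<^sub>t\<close> can have an eigenvalue \<open>\<i>\<omega>\<close>: if \<open>v\<close> were an eigenvector, then
  \<open>z = -\<Delta>\<^sub>t v\<close> would satisfy \<open>(\<i>\<omega>I - A) v = c\<lambda>BK z\<close>, that is \<open>v = G(\<i>\<omega>) z\<close>, and
  \<open>\<langle>v, z\<rangle> = -\<langle>v, \<Delta>\<^sub>t v\<rangle> < 0\<close> would put \<open>\<omega>\<close> into \<^const>\<open>Omega_tilde\<close> (lemma
  \<open>no_imaginary_eigenvalue\<close>). Since the matrix at \<open>t = 0\<close> is Hurwitz and the spectrum moves
  continuously without meeting the imaginary axis, the matrix at \<open>t = 1\<close> is Hurwitz as well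
  (lemma \<open>hurwitz_homotopy\<close>).

  Continuity of the spectrum enters as the fact that, along a path without imaginary
  eigenvalues, the parameters of the Hurwitz matrices form a set that is both open and closed in
  \<open>[0,1]\<close>. Openness is compactness: the eigenvalues of the path are bounded, so the pairs of a
  parameter and an eigenvalue in the closed right half plane form a compact set, whose projection
  is closed. For closedness, no root of the characteristic polynomial \<open>\<chi>\<close> may suddenly appear in
  the right half plane in a limit of Hurwitz matrices. This follows from an inequality
  that holds when all roots lie in the left half plane and that passes to limits, because it
  compares only two values of \<open>\<chi>\<close> (lemma \<open>hurwitz_charpoly_growth\<close>):
  \<open>|\<chi>(s + r)| \<le> (1 + r / Re s)\<^sup>n |\<chi>(s)|\<close> for \<open>Re s > 0\<close> and \<open>r \<ge> 0\<close>. Under it, a root \<open>s\<close> in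
  the right half plane would make the whole ray \<open>s + r\<close> consist of roots
  (lemma \<open>not_eigenvalue_of_growth\<close>).
\<close>

section \<open>The characteristic polynomial\<close>

definition charpoly :: "complex^'n^'n \<Rightarrow> complex poly" where
  "charpoly M = det (\<chi> i j. [:- (M $ i $ j), if i = j then 1 else 0:])"

lemma poly_charpoly: "poly (charpoly M) s = det (mat s - M)"
proof -
  have "poly [:- (M $ i $ j), if i = j then 1 else 0:] s = (mat s - M) $ i $ j" for i j
    by (simp add: mat_def)
  then show ?thesis
    unfolding charpoly_def det_def by (simp add: poly_sum poly_prod del: poly_pCons)
qed

lemma degree_charpoly_le: "degree (charpoly (M :: complex^'n^'n)) \<le> CARD('n)"
proof -
  have "degree (\<Prod>i\<in>UNIV. [:- (M $ i $ f i), if i = f i then 1 else 0:]) \<le> CARD('n)"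
    for f :: "'n \<Rightarrow> 'n"
  proof -
    let ?q = "\<lambda>i. [:- (M $ i $ f i), if i = f i then 1 else 0:]"
    have "degree (\<Prod>i\<in>UNIV. ?q i) \<le> sum (degree \<circ> ?q) UNIV"
      by (rule degree_prod_sum_le) simp
    also have "\<dots> \<le> (\<Sum>i\<in>(UNIV::'n set). 1)"
      by (rule sum_mono) simp
    finally show ?thesis by simp
  qed
  moreover have "degree (of_int k * q) \<le> degree q" for k and q :: "complex poly"
    using degree_mult_le[of "of_int k" q] by simp
  ultimately show ?thesis
    unfolding charpoly_def det_def
    by (auto intro!: degree_sum_le intro: order_trans)
qed

lemma mat_mult_vector: "mat k *v v = k *s v"
  for v :: "'a::comm_semiring_1^'n"
  by (simp add: vec_eq_iff matrix_vector_mult_def mat_def if_distrib[of "\<lambda>x. x * _"] cong: if_cong)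

lemma eigenvalue_iff_det: "eigenvalue M \<mu> \<longleftrightarrow> det (mat \<mu> - M) = 0"
proof -
  have "(mat \<mu> - M) *v v = 0 \<longleftrightarrow> M *v v = \<mu> *s v" for v
    by (auto simp: matrix_vector_mult_diff_rdistrib mat_mult_vector)
  moreover have "det (mat \<mu> - M) \<noteq> 0 \<longleftrightarrow> (\<forall>v. (mat \<mu> - M) *v v = 0 \<longrightarrow> v = 0)"
    by (simp add: invertible_det_nz[symmetric] invertible_left_inverse matrix_left_invertible_ker)
  ultimately show ?thesis
    unfolding eigenvalue_def by blast
qed

lemma continuous_on_det_mat_diff:
  fixes M :: "'a::topological_space \<Rightarrow> complex^'n^'n"
  assumes "continuous_on S M" "continuous_on S f"
  shows "continuous_on S (\<lambda>x. det (mat (f x) - M x))"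
proof -
  have "continuous_on S (\<lambda>x. (mat (f x) - M x) $ i $ j)" for i j
    using assms by (cases "i = j") (auto simp: mat_def intro!: continuous_intros)
  then show ?thesis
    unfolding det_def
    by (intro continuous_on_sum continuous_on_mult continuous_on_prod continuous_on_const) blast+
qed

section \<open>Bounds on eigenvalues and on the characteristic polynomial\<close>

text \<open>Compare \<open>M v = \<mu> v\<close> in the sum norm, where the sum of all entries bounds the operator norm.\<close>

lemma eigenvalue_norm_le:
  fixes M :: "complex^'n^'n"
  assumes "eigenvalue M \<mu>"
  shows "norm \<mu> \<le> (\<Sum>i\<in>UNIV. \<Sum>j\<in>UNIV. norm (M $ i $ j))"
proof -
  obtain v where v: "v \<noteq> 0" "M *v v = \<mu> *s v"
    using assms unfolding eigenvalue_def by blast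
  define S where "S = (\<Sum>i\<in>UNIV. norm (v $ i))"
  have le_S: "norm (v $ j) \<le> S" for j
    unfolding S_def by (rule member_le_sum) auto
  obtain k where "v $ k \<noteq> 0"
    using v(1) by (auto simp: vec_eq_iff)
  then have "S > 0"
    using le_S[of k] by (smt (verit) zero_less_norm_iff)
  have "norm \<mu> * S = (\<Sum>i\<in>UNIV. norm ((\<mu> *s v) $ i))"
    by (simp add: S_def sum_distrib_left norm_mult)
  also have "\<dots> = (\<Sum>i\<in>UNIV. norm (\<Sum>j\<in>UNIV. M $ i $ j * v $ j))"
    by (simp add: v(2)[symmetric] matrix_vector_mult_def)
  also have "\<dots> \<le> (\<Sum>i\<in>UNIV. \<Sum>j\<in>UNIV. norm (M $ i $ j) * S)"
    by (intro sum_mono order_trans[OF norm_sum])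
      (simp add: norm_mult mult_left_mono le_S)
  also have "\<dots> = (\<Sum>i\<in>UNIV. \<Sum>j\<in>UNIV. norm (M $ i $ j)) * S"
    by (simp add: sum_distrib_right)
  finally show ?thesis
    using \<open>S > 0\<close> by simp
qed

text \<open>A linear factor satisfies \<open>|s + r - \<mu>| \<le> |s - \<mu>| + r\<close>, and \<open>|s - \<mu>| \<ge> Re s\<close> because the root \<open>\<mu>\<close>
  lies to the left of the imaginary axis. So passing from \<open>s\<close> to \<open>s + r\<close> enlarges it at most
  by the factor \<open>1 + r / Re s\<close>. A bound \<open>n\<close> on the degree makes the constant the same along a
  whole family of polynomials.\<close>

lemma poly_growth_of_left_roots:
  fixes p :: "complex poly"
  assumes roots: "\<And>z. poly p z = 0 \<Longrightarrow> Re z < 0"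
    and deg: "degree p \<le> n" and s: "Re s > 0" and r: "r \<ge> 0"
  shows "norm (poly p (s + of_real r)) \<le> (1 + r / Re s) ^ n * norm (poly p s)"
proof -
  let ?C = "1 + r / Re s"
  have C: "?C \<ge> 1" using s r by simp
  obtain root where p: "smult (lead_coeff p) (\<Prod>i<degree p. [:-root i, 1:]) = p"
    using complex_poly_decompose' by blast
  have eval: "poly p x = lead_coeff p * (\<Prod>i<degree p. x - root i)" for x
    by (subst p[symmetric]) (simp add: poly_prod)
  have left: "Re (root i) < 0" if "i < degree p" for i
    using that by (intro roots) (auto simp: eval)
  have factor: "norm (s + of_real r - root i) \<le> ?C * norm (s - root i)" if "i < degree p" for i
  proof -
    have "Re s \<le> norm (s - root i)"
      using left[OF that] complex_Re_le_cmod[of "s - root i"] by simp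
    then have "r \<le> r / Re s * norm (s - root i)"
      using s r by (simp add: field_simps mult_left_mono)
    moreover have "norm (s + of_real r - root i) \<le> norm (s - root i) + r"
      using norm_triangle_ineq[of "s - root i" "of_real r"] r by (simp add: algebra_simps)
    ultimately show ?thesis
      by (simp add: algebra_simps)
  qed
  have "(\<Prod>i<degree p. norm (s + of_real r - root i)) \<le> (\<Prod>i<degree p. ?C * norm (s - root i))"
    by (intro prod_mono) (auto simp: factor)
  also have "\<dots> = ?C ^ degree p * (\<Prod>i<degree p. norm (s - root i))"
    by (simp add: prod.distrib)
  also have "\<dots> \<le> ?C ^ n * (\<Prod>i<degree p. norm (s - root i))"
    by (intro mult_right_mono power_increasing deg C prod_nonneg) auto
  finally have "norm (lead_coeff p) * (\<Prod>i<degree p. norm (s + of_real r - root i))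
      \<le> norm (lead_coeff p) * (?C ^ n * (\<Prod>i<degree p. norm (s - root i)))"
    by (rule mult_left_mono) simp
  then show ?thesis
    unfolding eval by (simp add: norm_mult prod_norm[symmetric] mult_ac)
qed

lemma hurwitz_charpoly_growth:
  fixes M :: "complex^'n^'n"
  assumes "hurwitz M" "Re s > 0" "r \<ge> 0"
  shows "norm (det (mat (s + of_real r) - M))
    \<le> (1 + r / Re s) ^ CARD('n) * norm (det (mat s - M))"
proof -
  have "Re z < 0" if "poly (charpoly M) z = 0" for z
    using that assms(1) by (auto simp: hurwitz_def eigenvalue_iff_det poly_charpoly)
  from poly_growth_of_left_roots[OF this degree_charpoly_le assms(2,3)] show ?thesis
    by (simp add: poly_charpoly)
qed

text \<open>By the growth bound, a root \<open>s\<close> with \<open>Re s > 0\<close> would propagate to all \<open>s + r\<close>, but the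
  spectrum is bounded.\<close>

lemma not_eigenvalue_of_growth:
  fixes M :: "complex^'n^'n"
  assumes growth: "\<And>r. r \<ge> 0 \<Longrightarrow> norm (det (mat (s + of_real r) - M))
      \<le> (1 + r / Re s) ^ CARD('n) * norm (det (mat s - M))"
    and s: "Re s > 0"
  shows "\<not> eigenvalue M s"
proof
  assume "eigenvalue M s"
  define b where "b = (\<Sum>i\<in>UNIV. \<Sum>j\<in>UNIV. norm (M $ i $ j))"
  have "b \<ge> 0" unfolding b_def by (intro sum_nonneg) auto
  then have "det (mat (s + of_real b) - M) = 0"
    using growth[of b] \<open>eigenvalue M s\<close> by (simp add: eigenvalue_iff_det)
  then have "norm (s + of_real b) \<le> b"
    unfolding b_def by (intro eigenvalue_norm_le) (simp add: eigenvalue_iff_det)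
  then show False
    using complex_Re_le_cmod[of "s + of_real b"] s by simp
qed

section \<open>Paths of matrices without imaginary eigenvalues\<close>

lemma hurwitz_homotopy:
  fixes M :: "real \<Rightarrow> complex^'n^'n"
  assumes cont: "continuous_on {0..1} M"
    and start: "hurwitz (M 0)"
    and no_imag: "\<And>t \<omega>. t \<in> {0..1} \<Longrightarrow> \<not> eigenvalue (M t) (\<i> * of_real \<omega>)"
  shows "hurwitz (M 1)"
proof -
  let ?h = "\<lambda>t s r. (1 + r / Re s) ^ CARD('n) * norm (det (mat s - M t))
      - norm (det (mat (s + of_real r) - M t))"
  \<comment> \<open>The growth bound instead of \<^const>\<open>hurwitz\<close>, to have a visibly closed set.\<close>
  define H where "H = (\<Inter>s\<in>{s. Re s > 0}. \<Inter>r\<in>{0..}. {t\<in>{0..1}. 0 \<le> ?h t s r})"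
  have "continuous_on {0..1} (\<lambda>t. ?h t s r)" for s r
    by (intro continuous_intros continuous_on_det_mat_diff cont)
  then have "closed {t\<in>{0..1}. 0 \<le> ?h t s r}" for s r
    using continuous_closed_preimage[of "{0..1}" "\<lambda>t. ?h t s r" "{0..}"]
    by (simp add: vimage_def Int_def conj_commute)
  then have "closed H"
    unfolding H_def by (intro closed_INT) auto
  have H_iff: "t \<in> H \<longleftrightarrow> hurwitz (M t)" if "t \<in> {0..1}" for t
  proof
    assume "hurwitz (M t)"
    then show "t \<in> H"
      using that hurwitz_charpoly_growth[of "M t"] by (auto simp: H_def)
  next
    assume "t \<in> H"
    show "hurwitz (M t)"
      unfolding hurwitz_def
    proof (intro allI impI)
      fix \<mu> assume ev: "eigenvalue (M t) \<mu>"
      have "Re \<mu> \<noteq> 0"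
      proof
        assume "Re \<mu> = 0"
        then have "\<mu> = \<i> * of_real (Im \<mu>)" by (simp add: complex_eq_iff)
        then show False using no_imag[OF that, of "Im \<mu>"] ev by simp
      qed
      moreover have "\<not> Re \<mu> > 0"
        using not_eigenvalue_of_growth[of \<mu> "M t"] \<open>t \<in> H\<close> ev by (auto simp: H_def)
      ultimately show "Re \<mu> < 0" by simp
    qed
  qed

  let ?b = "\<lambda>t. \<Sum>i\<in>UNIV. \<Sum>j\<in>UNIV. norm (M t $ i $ j)"
  have "continuous_on {0..1} ?b"
    by (intro continuous_on_sum continuous_on_norm continuous_on_component cont)
  then have "bounded (?b ` {0..1})"
    by (rule compact_imp_bounded[OF compact_continuous_image[OF _ compact_Icc]])
  then obtain b where "\<forall>x\<in>?b ` {0..1}. norm x \<le> b"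
    unfolding bounded_iff ..
  then have b: "norm (?b t) \<le> b" if "t \<in> {0..1}" for t
    by (rule bspec) (rule imageI[OF that])
  \<comment> \<open>\<open>U\<close> is the set of parameters with an eigenvalue in the closed right half plane; the bound \<open>b\<close>
    makes it the projection of a compact set.\<close>
  let ?D = "{0..1::real} \<times> (cball 0 b \<inter> {\<mu>. Re \<mu> \<ge> 0})"
  define Z where "Z = {x \<in> ?D. det (mat (snd x) - M (fst x)) = 0}"
  define U where "U = fst ` Z"
  have "compact ?D"
    by (intro compact_Times compact_Int_closed compact_cball compact_Icc closed_halfspace_Re_ge)
  have "continuous_on ?D (\<lambda>x. M (fst x))"
    by (rule continuous_on_compose2[OF cont continuous_on_fst[OF continuous_on_id]]) auto
  then have "continuous_on ?D (\<lambda>x. det (mat (snd x) - M (fst x)))"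
    by (intro continuous_on_det_mat_diff continuous_on_snd continuous_on_id)
  then have "closed Z"
    unfolding Z_def
    by (rule continuous_closed_preimage_constant) (rule compact_imp_closed[OF \<open>compact ?D\<close>])
  have "Z \<subseteq> ?D"
    unfolding Z_def by (rule Collect_restrict)
  then have "compact Z"
    using compact_Int_closed[OF \<open>compact ?D\<close> \<open>closed Z\<close>] by (simp only: Int_absorb1)
  then have "closed U"
    unfolding U_def
    by (rule compact_imp_closed[OF compact_continuous_image[OF continuous_on_fst[OF continuous_on_id]]])
  have U_iff: "t \<in> U \<longleftrightarrow> \<not> hurwitz (M t)" if "t \<in> {0..1}" for t
  proof -
    have "norm \<mu> \<le> b" if "eigenvalue (M t) \<mu>" for \<mu>
      using eigenvalue_norm_le[OF that] b[OF \<open>t \<in> {0..1}\<close>] by simp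
    then show ?thesis
      using that by (force simp: U_def Z_def hurwitz_def eigenvalue_iff_det not_less)
  qed

  have "H \<inter> {0..1} = {} \<or> U \<inter> {0..1} = {}"
    by (rule connected_closedD) (use \<open>closed H\<close> \<open>closed U\<close> H_iff U_iff in auto)
  moreover have "0 \<in> H \<inter> {0..1}"
    using H_iff[of 0] start by simp
  ultimately show ?thesis
    using U_iff[of 1] by auto
qed

section \<open>Gain perturbations\<close>

lemma closed_loop_mult_vector:
  "closed_loop A B K c l \<Delta> *v v
     = cmat A *v v - (cmat B ** cscale (of_real c * l) (cmat K)) *v (\<Delta> *v v)"
proof -
  have "cscale k (X ** Y ** \<Delta>) = X ** cscale k Y ** \<Delta>" for k and X :: "complex^'b^'a"
      and Y :: "complex^'a^'b"
    by (simp add: cscale_def map_matrix_def matrix_matrix_mult_def vec_eq_iff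
        sum_distrib_left sum_distrib_right mult_ac)
  then show ?thesis
    by (simp add: closed_loop_def matrix_vector_mult_diff_rdistrib matrix_vector_mul_assoc)
qed

text \<open>An eigenvector \<open>v\<close> for \<open>\<i>\<omega>\<close> yields the witness \<open>z = -\<Delta> v\<close> of membership of \<open>\<omega>\<close> in
  \<^const>\<open>Omega_tilde\<close>, with \<open>v\<close> in the role
  of \<open>G(\<i>\<omega>) z\<close>. This covers the case that \<open>\<i>\<omega>\<close> is an eigenvalue of \<open>A\<close>, too.\<close>

lemma no_imaginary_eigenvalue:
  assumes empty: "Omega_tilde A B K c l = {}"
    and pos: "\<And>z. z \<noteq> 0 \<Longrightarrow> 0 < herm_inner z (\<Delta> *v z)"
  shows "\<not> eigenvalue (closed_loop A B K c l \<Delta>) (\<i> * of_real \<omega>)"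
proof
  let ?s = "\<i> * of_real \<omega> :: complex"
  let ?R = "mat ?s - cmat A"
  let ?F = "cmat B ** cscale (of_real c * l) (cmat K)"
  assume "eigenvalue (closed_loop A B K c l \<Delta>) ?s"
  then obtain v where "v \<noteq> 0" and v: "closed_loop A B K c l \<Delta> *v v = ?s *s v"
    unfolding eigenvalue_def by blast
  define z where "z = - (\<Delta> *v v)"
  have "?F *v z = - (?F *v (\<Delta> *v v))"
    unfolding z_def by (simp add: vec_eq_iff matrix_vector_mult_def sum_negf)
  then have eq: "?R *v v = ?F *v z"
    using v
    by (simp add: closed_loop_mult_vector matrix_vector_mult_diff_rdistrib mat_mult_vector
        algebra_simps)
  have "herm_inner v z = - herm_inner v (\<Delta> *v v)"
    by (simp add: z_def herm_inner_def sum_negf)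
  then have neg: "herm_inner v z < 0"
    using pos[OF \<open>v \<noteq> 0\<close>] by simp
  have "loop_tf A B K c l ?s *v z = v" if "invertible ?R"
  proof -
    have "matrix_inv ?R ** ?R = mat 1"
      using that unfolding invertible_def matrix_inv_def by (rule someI2_ex) simp
    have "loop_tf A B K c l ?s *v z = matrix_inv ?R *v (?F *v z)"
      by (simp add: loop_tf_def matrix_vector_mul_assoc matrix_mul_assoc)
    also have "\<dots> = (matrix_inv ?R ** ?R) *v v"
      by (simp add: eq[symmetric] matrix_vector_mul_assoc)
    finally show ?thesis
      by (simp add: \<open>matrix_inv ?R ** ?R = mat 1\<close>)
  qed
  then have "\<omega> \<in> Omega_tilde A B K c l"
    unfolding Omega_tilde_def Let_def mem_Collect_eq using eq neg by (metis (no_types))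
  then show False
    using empty by simp
qed

lemma herm_inner_convex_pos:
  fixes \<Delta> :: "complex^'n^'n"
  assumes \<Delta>: "pos_def_hermitian \<Delta>" and t: "t \<in> {0..1}" and "z \<noteq> 0"
  shows "0 < herm_inner z (((1 - t) *\<^sub>R mat 1 + t *\<^sub>R \<Delta>) *v z)"
proof -
  have sq: "cnj w * w = of_real ((norm w)\<^sup>2)" for w
    by (metis complex_norm_square mult.commute)
  have "herm_inner z z = of_real (\<Sum>i\<in>UNIV. (norm (z $ i))\<^sup>2)"
    by (simp add: herm_inner_def sq)
  moreover have "(\<Sum>i\<in>UNIV. (norm (z $ i))\<^sup>2) > 0"
    using \<open>z \<noteq> 0\<close> by (auto simp: vec_eq_iff intro: sum_pos2)
  ultimately have self: "0 < herm_inner z z"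
    by (simp add: less_complex_def)
  have pos: "0 < herm_inner z (\<Delta> *v z)"
    using \<Delta> \<open>z \<noteq> 0\<close> by (simp add: pos_def_hermitian_def)
  have "(k *\<^sub>R X) *v z = k *\<^sub>R (X *v z)" for k and X :: "complex^'n^'n"
    by (simp add: vec_eq_iff matrix_vector_mult_def scaleR_sum_right)
  then have "((1 - t) *\<^sub>R mat 1 + t *\<^sub>R \<Delta>) *v z = (1 - t) *\<^sub>R z + t *\<^sub>R (\<Delta> *v z)"
    by (simp add: matrix_vector_mult_add_rdistrib)
  then have "herm_inner z (((1 - t) *\<^sub>R mat 1 + t *\<^sub>R \<Delta>) *v z)
      = (1 - t) *\<^sub>R herm_inner z z + t *\<^sub>R herm_inner z (\<Delta> *v z)"
    by (simp add: herm_inner_def ring_distribs sum.distrib scaleR_sum_right)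
  then show ?thesis
    using self pos t
    by (cases "t = 0") (auto simp: less_complex_def intro: add_nonneg_pos)
qed

lemma hurwitz_closed_loop:
  assumes nominal: "hurwitz (closed_loop A B K c l (mat 1))"
    and empty: "Omega_tilde A B K c l = {}" and \<Delta>: "pos_def_hermitian \<Delta>"
  shows "hurwitz (closed_loop A B K c l \<Delta>)"
proof -
  let ?M = "\<lambda>t. closed_loop A B K c l ((1 - t) *\<^sub>R mat 1 + t *\<^sub>R \<Delta>)"
  have "continuous_on {0..1} (\<lambda>t. ?M t)"
    unfolding closed_loop_def cscale_def map_matrix_def matrix_matrix_mult_def
    by (intro continuous_intros)
  moreover have "hurwitz (?M 0)"
    using nominal by simp
  moreover have "\<not> eigenvalue (?M t) (\<i> * of_real \<omega>)" if "t \<in> {0..1}" for t \<omega>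
    by (rule no_imaginary_eigenvalue[OF empty herm_inner_convex_pos[OF \<Delta> that]])
  ultimately have "hurwitz (?M 1)"
    by (rule hurwitz_homotopy)
  then show ?thesis
    by simp
qed

theorem mainTheorem10:
  fixes a :: "real^'N^'N"
    and A :: "real^'n^'n" and B :: "real^'m^'n" and K :: "real^'n^'m"
    and c :: real and lam :: "nat \<Rightarrow> complex"
  assumes weights_nonneg: "\<And>i k. a $ i $ k \<ge> 0"
    and strongly_conn: "strongly_connected (arcs a)"
    and spanning_tree: "\<exists>r T. directed_spanning_tree (arcs a) r T"
    and spectrum: "eigenvalue_list (cmat (laplacian a)) lam"
    and lam_1: "lam 1 = 0"
    and stabilizable: "stabilizable A B"
    and K_stabilizing: "hurwitz (cmat (A - B ** K))"
    and loops_stable: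
      "\<And>p. p \<in> {2..CARD('N)} \<Longrightarrow>
         hurwitz (cmat A - cscale (of_real c * lam p) (cmat B ** cmat K))"
    and Omega_empty: "\<And>p. p \<in> {2..CARD('N)} \<Longrightarrow> Omega_tilde A B K c (lam p) = {}"
  shows "mas_stable_gain_independent A B K c CARD('N) lam"
  unfolding mas_stable_gain_independent_def mas_stable_def
proof (intro allI impI ballI)
  fix \<Delta> :: "nat \<Rightarrow> complex^'n^'n" and p
  assume pos: "\<forall>p\<in>{2..CARD('N)}. pos_def_hermitian (\<Delta> p)" and p: "p \<in> {2..CARD('N)}"
  have "hurwitz (closed_loop A B K c (lam p) (mat 1))"
    using loops_stable[OF p] by (simp add: closed_loop_def)
  then show "hurwitz (closed_loop A B K c (lam p) (\<Delta> p))"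
    by (rule hurwitz_closed_loop[OF _ Omega_empty[OF p] bspec[OF pos p]])
qed

end
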